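(* If $n_1\ge n_2\ge n_3\ge 4$, then $\mu_{\rm t}(K_{n_1}\,\square\, K_{n_2}\,\square\, K_{n_3}) = n_1+n_2+n_3-6$.
   Context: For a connected graph $G$ and $X\subseteq V(G)$, two vertices $x,y$ are $X$-visible if there is a shortest $x,y$-path none of whose internal vertices lies in $X$. $X$ is a total mutual-visibility set if every two vertices of $V(G)$ are $X$-visible. $\mu_{\rm t}(G)$ is the maximum cardinality of a total mutual-visibility set of $G$. $\square$ denotes the Cartesian product of graphs and $K_n$ the complete graph on $n$ vertices. *)

theory Defs
  imports "Graph_Theory.Graph_Theory"
begin

(* Undirected simple graphs are represented, as in Graph_Theory, by symmetric loop-free digraphs;
   K\<^bsub>n\<^esub> G (complete_digraph n G) says that G is a complete graph on n vertices. *)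

definition cartesian_product ::
  "'a pair_pre_digraph \<Rightarrow> 'b pair_pre_digraph \<Rightarrow> ('a \<times> 'b) pair_pre_digraph" (infixr \<open>\<box>\<close> 75) where
  "G \<box> H = \<lparr> pverts = pverts G \<times> pverts H,
     parcs = {((g, h), (g', h')).
        (g = g' \<and> g \<in> pverts G \<and> (h, h') \<in> parcs H) \<or>
        ((g, g') \<in> parcs G \<and> h = h' \<and> h \<in> pverts H)} \<rparr>"

context pre_digraph
begin

definition shortest_path :: "'a \<Rightarrow> 'b awalk \<Rightarrow> 'a \<Rightarrow> bool" where
  "shortest_path x p y \<longleftrightarrow> apath x p y \<and> (\<forall>q. apath x q y \<longrightarrow> length p \<le> length q)"

definition visible :: "'a set \<Rightarrow> 'a \<Rightarrow> 'a \<Rightarrow> bool" where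
  "visible X x y \<longleftrightarrow> (\<exists>p. shortest_path x p y \<and> set (inner_verts p) \<inter> X = {})"

definition total_mutual_visibility_set :: "'a set \<Rightarrow> bool" where
  "total_mutual_visibility_set X \<longleftrightarrow>
     X \<subseteq> verts G \<and> (\<forall>x \<in> verts G. \<forall>y \<in> verts G. visible X x y)"

(* Meaningful for finite connected G only: then the empty set qualifies and the maximum exists.
   If G is disconnected, no set qualifies and the maximum is unspecified. *)
definition total_mutual_visibility_number :: nat (\<open>\<mu>\<^sub>t\<close>) where
  "\<mu>\<^sub>t = Max {card X | X. total_mutual_visibility_set X}"

end

end

theory Submission
  imports Defs
begin

(* In a Hamming graph K_m x K_n x K_l, a set X is totally mutually visible iff no two of its vertices
   are at distance exactly 2: the two common neighbours of opposite corners of a square are themselves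
   opposite corners of a square, and at distance 3 the inner vertices form a 6-cycle in which
   X meets each of the two triples of alternate vertices at most once.

   For the upper bound let R be a maximum subset of X with pairwise distances 3. Each x in X - R is
   adjacent to some r in R, in a direction i depending on r only; i and the i-th coordinate of x
   determine x, and no vertex in R shares that coordinate. With I the set of directions, |I| <= |R|, so
   |X| <= |R| + (SUM i:I. n_i - |R|), which is at most n_1 + n_2 + n_3 - 6 if all n_i >= 4.
   Equality holds for three lines, one in each direction and with n_i - 2 points. *)

section \<open>Coordinates and Hamming distance of triples\<close>

text \<open>The sum type puts the three differently typed coordinates into one type, so that the
  index \<open>i\<close> can be a variable. Only \<open>i < 3\<close> is meaningful.\<close>

definition coord :: "'a \<times> 'b \<times> 'c \<Rightarrow> nat \<Rightarrow> 'a + 'b + 'c" where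
  "coord x i = (case x of (a, b, c) \<Rightarrow> [Inl a, Inr (Inl b), Inr (Inr c)] ! i)"

text \<open>Its cardinality is the Hamming distance; the set itself also records the
  directions.\<close>

definition diff :: "'a \<times> 'b \<times> 'c \<Rightarrow> 'a \<times> 'b \<times> 'c \<Rightarrow> nat set" where
  "diff x y = {i. i < 3 \<and> coord x i \<noteq> coord y i}"

lemma less_3_iff: "i < 3 \<longleftrightarrow> i = 0 \<or> i = 1 \<or> i = (2::nat)"
  by auto

lemma diff_eq:
  "diff (a, b, c) (a', b', c') =
    (if a = a' then {} else {0}) \<union> (if b = b' then {} else {1}) \<union> (if c = c' then {} else {2})"
  by (auto simp: diff_def coord_def less_3_iff)

lemma card_diff:
  "card (diff (a, b, c) (a', b', c')) = of_bool (a \<noteq> a') + of_bool (b \<noteq> b') + of_bool (c \<noteq> c')"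
  by (simp add: diff_eq)

lemma diff_subset: "diff x y \<subseteq> {..<3}"
  by (auto simp: diff_def)

lemma finite_diff [simp]: "finite (diff x y)"
  using diff_subset finite_subset by blast

lemma diff_commute: "diff x y = diff y x"
  by (auto simp: diff_def)

lemma diff_empty_iff: "diff x y = {} \<longleftrightarrow> x = y"
  by (cases x; cases y) (simp add: diff_eq)

lemma diff_triangle: "diff x z \<subseteq> diff x y \<union> diff y z"
  by (auto simp: diff_def)

lemma card_diff_triangle: "card (diff x z) \<le> card (diff x y) + card (diff y z)"
  by (rule order_trans[OF card_mono[OF _ diff_triangle[of x z y]] card_Un_le]) simp

text \<open>Both points agree with \<open>r\<close> outside \<open>i\<close> and \<open>j\<close>,
  and at each of these two positions exactly one of them deviates from \<open>r\<close>. Two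
  directions at a single \<open>r\<close> thus produce the excluded distance 2.\<close>

lemma diff_via_singletons:
  assumes "diff r x = {i}" "diff r y = {j}" "i \<noteq> j"
  shows "diff x y = {i, j}"
proof -
  have "k \<in> diff r x \<longleftrightarrow> k = i" "k \<in> diff r y \<longleftrightarrow> k = j" for k
    using assms by simp_all
  then have "k \<in> diff x y \<longleftrightarrow> k = i \<or> k = j" for k
    using assms(3) unfolding diff_def mem_Collect_eq by metis
  then show ?thesis by auto
qed

lemma diff_cases:
  assumes "card (diff x y) \<noteq> 2"
  obtains "x = y" | i where "i < 3" "diff x y = {i}" | "diff x y = {..<3}"
proof -
  have "card (diff x y) \<le> 3"
    using card_mono[OF _ diff_subset[of x y]] by simp
  then consider "card (diff x y) = 0" | "card (diff x y) = 1" | "card (diff x y) = 3"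
    using assms by linarith
  then show thesis
  proof cases
    case 1
    then show thesis using that(1) by (simp add: diff_empty_iff)
  next
    case 2
    then show thesis using that(2) diff_subset[of x y] by (auto simp: card_1_singleton_iff)
  next
    case 3
    then show thesis using that(3) card_subset_eq[OF _ diff_subset, of x y] by simp
  qed
qed

lemma coord_eq_iff: "i < 3 \<Longrightarrow> coord x i = coord y i \<longleftrightarrow> i \<notin> diff x y"
  by (auto simp: diff_def)

section \<open>Upper bound for sets without pairs at distance 2\<close>

text \<open>No graph is involved: \<open>W i\<close> is a pool of values for coordinate
  \<open>i\<close>, which allows an argument uniform in \<open>i\<close>. The truncated
  \<open>- 6\<close> is harmless, since the three cardinalities are at least 4 each.\<close>

lemma card_no_distance_2_le:
  fixes X :: "('a \<times> 'b \<times> 'c) set"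
  assumes fin: "finite X"
    and W: "\<And>i. i < 3 \<Longrightarrow> finite (W i)" "\<And>i. i < 3 \<Longrightarrow> card (W i) \<ge> 4"
      "\<And>x i. x \<in> X \<Longrightarrow> i < 3 \<Longrightarrow> coord x i \<in> W i"
    and no2: "\<And>x y. x \<in> X \<Longrightarrow> y \<in> X \<Longrightarrow> card (diff x y) \<noteq> 2"
  shows "card X \<le> card (W 0) + card (W 1) + card (W 2) - 6"
proof -
  define far where "far R \<longleftrightarrow> R \<subseteq> X \<and> (\<forall>x\<in>R. \<forall>y\<in>R. x \<noteq> y \<longrightarrow> diff x y = {..<3})" for R
  have "far {}" by (simp add: far_def)
  moreover have "\<forall>R. far R \<longrightarrow> card R < Suc (card X)"
    using fin by (auto simp: far_def card_mono less_Suc_eq_le)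
  ultimately obtain R where R: "far R" and max: "\<And>S. far S \<Longrightarrow> card S \<le> card R"
    using ex_has_greatest_nat[of far "{}" card "Suc (card X)"] by metis
  have RX: "R \<subseteq> X" and apart: "\<And>r s. r \<in> R \<Longrightarrow> s \<in> R \<Longrightarrow> r \<noteq> s \<Longrightarrow> diff r s = {..<3}"
    using R by (auto simp: far_def)
  have finR: "finite R" using RX fin finite_subset by blast
  \<comment> \<open>By \<open>diff_cases\<close>, an \<open>x\<close> without a neighbour in
    \<open>R\<close> is at distance 3 from all of \<open>R\<close>, so \<open>insert x R\<close>
    would contradict maximality.\<close>
  have "\<exists>r i. r \<in> R \<and> i < 3 \<and> diff r x = {i}" if x: "x \<in> X - R" for x
  proof (rule ccontr)
    assume none: "\<nexists>r i. r \<in> R \<and> i < 3 \<and> diff r x = {i}"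
    have "diff r x = {..<3}" if "r \<in> R" for r
      using diff_cases[OF no2, of r x] that x RX none by blast
    moreover from this have "diff x r = {..<3}" if "r \<in> R" for r
      using that diff_commute[of x r] by simp
    ultimately have "far (insert x R)"
      using x RX apart by (simp add: far_def)
    then show False
      using max[of "insert x R"] x finR by simp
  qed
  then obtain \<rho> \<delta> where \<rho>: "\<And>x. x \<in> X - R \<Longrightarrow> \<rho> x \<in> R"
    and \<delta>: "\<And>x. x \<in> X - R \<Longrightarrow> \<delta> x < 3" "\<And>x. x \<in> X - R \<Longrightarrow> diff (\<rho> x) x = {\<delta> x}"
    by metis
  define I where "I = \<delta> ` (X - R)"
  have I3: "I \<subseteq> {..<3}" using \<delta>(1) by (auto simp: I_def)
  then have finI: "finite I" using finite_subset by blast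
  have same_direction: "\<delta> x = \<delta> y" if "x \<in> X - R" "y \<in> X - R" "\<rho> x = \<rho> y" for x y
    using diff_via_singletons[of "\<rho> x" x "\<delta> x" y "\<delta> y"] that \<delta>(2)[of x] \<delta>(2)[of y] no2[of x y] by auto
  \<comment> \<open>Hence \<delta> factors through \<rho>: \<open>inv_into\<close> picks a
    representative in each fibre of \<rho>, and there are at most \<open>card R\<close>
    fibres.\<close>
  have "\<delta> x = \<delta> (inv_into (X - R) \<rho> (\<rho> x))" if "x \<in> X - R" for x
    using that same_direction[of x "inv_into (X - R) \<rho> (\<rho> x)"]
    by (metis f_inv_into_f imageI inv_into_into)
  then have "I \<subseteq> (\<lambda>r. \<delta> (inv_into (X - R) \<rho> r)) ` \<rho> ` (X - R)"
    unfolding I_def by blast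
  then have "card I \<le> card (\<rho> ` (X - R))"
    using fin by (intro surj_card_le) auto
  also have "\<dots> \<le> card R"
    using \<rho> finR by (intro card_mono) auto
  finally have cardI: "card I \<le> card R" .

  \<comment> \<open>The values of coordinate \<open>i\<close> occupied by \<open>R\<close>. There
    are exactly \<open>card R\<close> of them, because distinct members of \<open>R\<close> differ
    in every coordinate.\<close>
  define C where "C i = (\<lambda>r. coord r i) ` R" for i
  have finC: "finite (C i)" for i
    using finR by (simp add: C_def)
  have cardC: "card (C i) = card R" and CW: "C i \<subseteq> W i" if "i < 3" for i
  proof -
    have "inj_on (\<lambda>r. coord r i) R"
      by (rule inj_onI) (metis apart coord_eq_iff lessThan_iff that)
    then show "card (C i) = card R" by (simp add: C_def card_image)
    show "C i \<subseteq> W i" using W(3) RX that by (auto simp: C_def)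
  qed
  have RW: "card R \<le> card (W i)" if "i < 3" for i
    using card_mono[OF W(1) CW] cardC that by simp
  \<comment> \<open>This map will inject \<open>X - R\<close> into the pairs of a direction in
    \<open>I\<close> and an unoccupied value for that direction.\<close>
  define \<phi> where "\<phi> x = (\<delta> x, coord x (\<delta> x))" for x
  \<comment> \<open>Suppose \<open>x\<close> shares coordinate \<open>\<delta> x\<close> with some
    \<open>r\<close> in \<open>R\<close>. Then \<open>r\<close> is not \<open>\<rho> x\<close>, so
    it differs from \<open>\<rho> x\<close> everywhere. As \<open>x\<close> deviates from
    \<open>\<rho> x\<close> only in direction \<open>\<delta> x\<close>, it differs from
    \<open>r\<close> in exactly the other two coordinates.\<close>
  have new: "coord x (\<delta> x) \<notin> C (\<delta> x)" if x: "x \<in> X - R" for x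
  proof
    assume "coord x (\<delta> x) \<in> C (\<delta> x)"
    then obtain r where r: "r \<in> R" "\<delta> x \<notin> diff r x"
      using \<delta>(1)[OF x] by (auto simp: C_def coord_eq_iff diff_commute[of x])
    then have "r \<noteq> \<rho> x" using \<delta>(2)[OF x] by auto
    then have "diff r (\<rho> x) = {..<3}" using apart r \<rho>[OF x] by blast
    then have 3: "{..<3} \<subseteq> diff r x \<union> {\<delta> x}"
      using diff_triangle[of r "\<rho> x" x] \<delta>(2)[OF x] by (simp add: diff_commute[of x])
    have "diff r x = {..<3} - {\<delta> x}"
      using 3 r(2) diff_subset[of r x] by blast
    then have "card (diff r x) = 2" using \<delta>(1)[OF x] by simp
    then show False using no2 r x RX by blast
  qed
  have "inj_on \<phi> (X - R)"
  proof (rule inj_onI, rule ccontr)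
    fix x y assume x: "x \<in> X - R" and y: "y \<in> X - R" and "\<phi> x = \<phi> y" and ne: "x \<noteq> y"
    then have d: "\<delta> y = \<delta> x" "\<delta> x \<notin> diff x y"
      using \<delta>(1)[OF x] by (auto simp: \<phi>_def coord_eq_iff)
    \<comment> \<open>Away from the common direction, \<open>x\<close> and \<open>y\<close> agree
      with \<open>\<rho> x\<close> and \<open>\<rho> y\<close>. So their difference set is empty or
      has two elements, according to whether \<open>\<rho> x = \<rho> y\<close>; both are
      impossible.\<close>
    have "diff x y \<subseteq> {\<delta> x} \<union> diff (\<rho> x) (\<rho> y)" "diff (\<rho> x) (\<rho> y) \<subseteq> {\<delta> x} \<union> diff x y"
      using \<delta>(2)[OF x] \<delta>(2)[OF y] d(1)
        diff_triangle[of x y "\<rho> x"] diff_triangle[of "\<rho> x" y "\<rho> y"]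
        diff_triangle[of "\<rho> x" "\<rho> y" x] diff_triangle[of x "\<rho> y" y]
      by (auto simp: diff_commute[of x "\<rho> x"] diff_commute[of y "\<rho> y"])
    then have eq: "diff x y = diff (\<rho> x) (\<rho> y) - {\<delta> x}" using d(2) by blast
    show False
    proof (cases "\<rho> x = \<rho> y")
      case True
      then have "diff x y = {}" using eq diff_empty_iff[of "\<rho> x" "\<rho> y"] by simp
      then show False using ne by (simp add: diff_empty_iff)
    next
      case False
      then have "diff x y = {..<3} - {\<delta> x}" using eq apart \<rho> x y by simp
      then have "card (diff x y) = 2" using \<delta>(1)[OF x] by simp
      then show False using no2 x y by blast
    qed
  qed
  moreover have "\<phi> ` (X - R) \<subseteq> Sigma I (\<lambda>i. W i - C i)"
    using new W(3) \<delta>(1) by (auto simp: \<phi>_def I_def)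
  moreover have "finite (Sigma I (\<lambda>i. W i - C i))"
    using finI I3 W(1) by (intro finite_SigmaI) auto
  ultimately have "card (X - R) \<le> card (Sigma I (\<lambda>i. W i - C i))"
    by (rule card_inj_on_le)
  also have "\<dots> = (\<Sum>i\<in>I. card (W i - C i))"
    using finI I3 W(1) by (intro card_SigmaI) auto
  also have "\<dots> = (\<Sum>i\<in>I. card (W i) - card R)"
    using I3 W(1) by (intro sum.cong refl) (auto simp: card_Diff_subset cardC CW finC)
  finally have "card X \<le> card R + (\<Sum>i\<in>I. card (W i) - card R)"
    using card_Diff_subset[OF finR RX] card_mono[OF fin RX] by linarith
  \<comment> \<open>With \<open>r = card R\<close>, the bound is \<open>r\<close> for no direction,
    a single \<open>card (W i)\<close> for one direction, and two of these cardinalities minus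
    \<open>r\<close> for two, where \<open>r \<ge> 2\<close> and the third cardinality is at least
    4. For three directions it is the full sum minus \<open>2 * r\<close>, with
    \<open>r \<ge> 3\<close>. \<open>RW\<close> rules out truncation in the summands.\<close>
  moreover have "I \<in> Pow {0, 1, 2}" using I3 by (auto simp: less_3_iff)
  then have "I \<in> {{}, {0}, {1}, {2}, {0, 1}, {0, 2}, {1, 2}, {0, 1, 2}}"
    by (simp add: Pow_insert) blast
  ultimately show ?thesis
    using cardI W(2)[of 0] W(2)[of 1] W(2)[of 2] RW[of 0] RW[of 1] RW[of 2] by auto
qed

section \<open>Construction attaining the bound\<close>

lemma exists_no_distance_2_set:
  assumes "finite A" "finite B" "finite C" and "card A \<ge> 4" "card B \<ge> 4" "card C \<ge> 4"
  obtains X where "X \<subseteq> A \<times> B \<times> C" "card X = card A + card B + card C - 6"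
    "\<And>x y. x \<in> X \<Longrightarrow> y \<in> X \<Longrightarrow> card (diff x y) \<noteq> 2"
proof -
  obtain a a' where a: "a \<in> A" "a' \<in> A" "a \<noteq> a'"
    using card_le_Suc0_iff_eq[of A] assms by auto
  obtain b b' where b: "b \<in> B" "b' \<in> B" "b \<noteq> b'"
    using card_le_Suc0_iff_eq[of B] assms by auto
  obtain c c' where c: "c \<in> C" "c' \<in> C" "c \<noteq> c'"
    using card_le_Suc0_iff_eq[of C] assms by auto
  \<comment> \<open>Points on one line differ in at most one coordinate. The fixed coordinates and
    the two values removed from each line are chosen so that points on different lines differ in all
    three.\<close>
  define X\<^sub>1 where "X\<^sub>1 = (A - {a, a'}) \<times> {b} \<times> {c}"
  define X\<^sub>2 where "X\<^sub>2 = {a} \<times> (B - {b, b'}) \<times> {c'}"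
  define X\<^sub>3 where "X\<^sub>3 = {a'} \<times> {b'} \<times> (C - {c, c'})"
  have "card X\<^sub>1 = card A - 2" "card X\<^sub>2 = card B - 2" "card X\<^sub>3 = card C - 2"
    using a b c assms by (simp_all add: X\<^sub>1_def X\<^sub>2_def X\<^sub>3_def card_cartesian_product card_Diff_subset)
  moreover have "X\<^sub>1 \<inter> X\<^sub>2 = {}" "(X\<^sub>1 \<union> X\<^sub>2) \<inter> X\<^sub>3 = {}"
    using a b c by (auto simp: X\<^sub>1_def X\<^sub>2_def X\<^sub>3_def)
  moreover have "finite X\<^sub>1" "finite X\<^sub>2" "finite X\<^sub>3"
    using assms by (simp_all add: X\<^sub>1_def X\<^sub>2_def X\<^sub>3_def)
  ultimately have "card (X\<^sub>1 \<union> X\<^sub>2 \<union> X\<^sub>3) = (card A - 2) + (card B - 2) + (card C - 2)"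
    by (simp add: card_Un_disjoint)
  then have "card (X\<^sub>1 \<union> X\<^sub>2 \<union> X\<^sub>3) = card A + card B + card C - 6"
    using assms by linarith
  moreover have "X\<^sub>1 \<union> X\<^sub>2 \<union> X\<^sub>3 \<subseteq> A \<times> B \<times> C"
    using a b c by (auto simp: X\<^sub>1_def X\<^sub>2_def X\<^sub>3_def)
  moreover have "card (diff x y) \<noteq> 2" if "x \<in> X\<^sub>1 \<union> X\<^sub>2 \<union> X\<^sub>3" "y \<in> X\<^sub>1 \<union> X\<^sub>2 \<union> X\<^sub>3" for x y
    using that a b c by (auto simp: X\<^sub>1_def X\<^sub>2_def X\<^sub>3_def card_diff of_bool_def split: if_splits)
  ultimately show thesis using that by blast
qed

section \<open>Visibility in Hamming graphs\<close>

locale hamming_graph =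
  fixes G :: "('a \<times> 'b \<times> 'c) pair_pre_digraph" and A :: "'a set" and B :: "'b set" and C :: "'c set"
  assumes pverts_eq: "pverts G = A \<times> B \<times> C"
    and parcs_eq: "parcs G = {(x, y). x \<in> pverts G \<and> y \<in> pverts G \<and> card (diff x y) = 1}"

sublocale hamming_graph \<subseteq> pair_wf_digraph G
  by unfold_locales (auto simp: parcs_eq)

context hamming_graph
begin

text \<open>Every arc changes exactly one coordinate, so the triangle inequality applies along the
  walk.\<close>

lemma card_diff_le_length: "awalk x p y \<Longrightarrow> card (diff x y) \<le> length p"
proof (induction p arbitrary: x)
  case Nil
  then show ?case by (simp add: awalk_Nil_iff diff_empty_iff)
next
  case (Cons e p)
  then have "e \<in> parcs G" "x = fst e" "awalk (snd e) p y"
    by (simp_all add: awalk_Cons_iff)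
  then have "card (diff x (snd e)) = 1" "card (diff (snd e) y) \<le> length p"
    using Cons.IH by (auto simp: parcs_eq)
  then show ?case using card_diff_triangle[of x y "snd e"] by simp
qed

text \<open>A path whose length equals the Hamming distance is shortest by
  \<open>card_diff_le_length\<close>, so minimality need not be checked against other paths each
  time.\<close>

lemma visibleI:
  assumes "apath x p y" "length p = card (diff x y)" "set (inner_verts p) \<inter> X = {}"
  shows "visible X x y"
  using assms card_diff_le_length awalkI_apath unfolding visible_def shortest_path_def by metis

lemma visible_distance_1:
  assumes "x \<in> pverts G" "y \<in> pverts G" "card (diff x y) \<le> 1"
  shows "visible X x y"
proof (cases "x = y")
  case True
  then show ?thesis
    using assms by (intro visibleI[of _ "[]"]) (auto simp: apath_Nil_iff diff_empty_iff)
next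
  case False
  then have "card (diff x y) = 1" using assms diff_empty_iff[of x y] by (simp add: le_Suc_eq)
  then show ?thesis
    using assms False by (intro visibleI[of _ "[(x, y)]"])
      (auto simp: apath_Cons_iff apath_Nil_iff parcs_eq)
qed

lemma visible_distance_2:
  assumes "x \<in> pverts G" "y \<in> pverts G" "u \<in> pverts G - X"
    and "card (diff x y) = 2" "card (diff x u) = 1" "card (diff u y) = 1"
  shows "visible X x y"
proof (rule visibleI)
  show "apath x [(x, u), (u, y)] y"
    using assms diff_empty_iff[of x y] diff_empty_iff[of x u] diff_empty_iff[of u y]
    by (auto simp: apath_Cons_iff apath_Nil_iff parcs_eq)
qed (use assms in \<open>auto simp: inner_verts_def\<close>)

lemma visible_distance_3:
  assumes "x \<in> pverts G" "y \<in> pverts G" "u \<in> pverts G - X" "v \<in> pverts G - X"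
    and "card (diff x y) = 3" "card (diff x u) = 1" "card (diff u v) = 1" "card (diff v y) = 1"
  shows "visible X x y"
proof (rule visibleI)
  \<comment> \<open>An \<open>apath\<close> has distinct vertices. Consecutive ones are at distance
    1, and any other coincidence would bring \<open>x\<close> and \<open>y\<close> closer than
    3.\<close>
  have "x \<noteq> u" "u \<noteq> v" "v \<noteq> y" "x \<noteq> y" "x \<noteq> v" "u \<noteq> y"
    using assms card_diff_triangle[of x y u] card_diff_triangle[of u y v] diff_empty_iff[of v v]
      diff_empty_iff[of u u] diff_empty_iff[of y y] by auto
  then show "apath x [(x, u), (u, v), (v, y)] y"
    using assms by (auto simp: apath_Cons_iff apath_Nil_iff parcs_eq)
qed (use assms in \<open>auto simp: inner_verts_def\<close>)

lemma visible_if_no_distance_2: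
  assumes no2: "\<And>x y. x \<in> X \<Longrightarrow> y \<in> X \<Longrightarrow> card (diff x y) \<noteq> 2"
    and x: "x \<in> pverts G" and y: "y \<in> pverts G"
  shows "visible X x y"
proof -
  obtain a b c where X: "x = (a, b, c)" by (cases x)
  obtain a' b' c' where Y: "y = (a', b', c')" by (cases y)
  have mem: "a \<in> A" "b \<in> B" "c \<in> C" "a' \<in> A" "b' \<in> B" "c' \<in> C"
    using x y by (auto simp: X Y pverts_eq)
  have "card (diff x y) \<le> 3" by (simp add: X Y card_diff)
  then consider "card (diff x y) \<le> 1" | "card (diff x y) = 2" | "card (diff x y) = 3"
    by linarith
  then show ?thesis
  proof cases
    case 1
    then show ?thesis using x y by (rule visible_distance_1[rotated 2])
  next
    case 2
    \<comment> \<open>The witnesses are the other two corners of the square spanned by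
      \<open>x\<close> and \<open>y\<close>; being at distance 2, they cannot both lie in
      \<open>X\<close>.\<close>
    then have "\<exists>u v. u \<in> pverts G \<and> v \<in> pverts G \<and> card (diff u v) = 2 \<and>
      card (diff x u) = 1 \<and> card (diff u y) = 1 \<and> card (diff x v) = 1 \<and> card (diff v y) = 1"
    proof -
      consider "a \<noteq> a'" "b \<noteq> b'" "c = c'" | "a \<noteq> a'" "b = b'" "c \<noteq> c'" | "a = a'" "b \<noteq> b'" "c \<noteq> c'"
        using 2 by (auto simp: X Y card_diff of_bool_def split: if_splits)
      then show ?thesis
      proof cases
        case 1
        then show ?thesis using mem
          by (intro exI[of _ "(a, b', c)"] exI[of _ "(a', b, c)"]) (auto simp: X Y card_diff pverts_eq)
      next
        case 2
        then show ?thesis using mem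
          by (intro exI[of _ "(a, b, c')"] exI[of _ "(a', b, c)"]) (auto simp: X Y card_diff pverts_eq)
      next
        case 3
        then show ?thesis using mem
          by (intro exI[of _ "(a, b', c)"] exI[of _ "(a, b, c')"]) (auto simp: X Y card_diff pverts_eq)
      qed
    qed
    then show ?thesis
      using visible_distance_2[OF x y _ 2] no2 by blast
  next
    case 3
    then have ne: "a \<noteq> a'" "b \<noteq> b'" "c \<noteq> c'"
      by (auto simp: X Y card_diff of_bool_def split: if_splits)
    have path: ?thesis if "u \<in> pverts G" "v \<in> pverts G" "u \<notin> X" "v \<notin> X" "card (diff x u) = 1"
      "card (diff u v) = 1" "card (diff v y) = 1" for u v
      using visible_distance_3[OF x y, of u X v] that 3 by blast
    let ?u\<^sub>1 = "(a', b, c)" and ?u\<^sub>2 = "(a, b', c)" and ?u\<^sub>3 = "(a, b, c')"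
    let ?v\<^sub>1 = "(a, b', c')" and ?v\<^sub>2 = "(a', b, c')" and ?v\<^sub>3 = "(a', b', c)"
    \<comment> \<open>The neighbours of \<open>x\<close> on the 6-cycle are pairwise at distance 2,
      and so are those of \<open>y\<close>; hence \<open>X\<close> contains at most one from each
      triple.\<close>
    have u: "?u\<^sub>1 \<notin> X \<or> ?u\<^sub>2 \<notin> X" "?u\<^sub>1 \<notin> X \<or> ?u\<^sub>3 \<notin> X" "?u\<^sub>2 \<notin> X \<or> ?u\<^sub>3 \<notin> X"
      and v: "?v\<^sub>1 \<notin> X \<or> ?v\<^sub>2 \<notin> X" "?v\<^sub>1 \<notin> X \<or> ?v\<^sub>3 \<notin> X" "?v\<^sub>2 \<notin> X \<or> ?v\<^sub>3 \<notin> X"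
      using no2[of ?u\<^sub>1 ?u\<^sub>2] no2[of ?u\<^sub>1 ?u\<^sub>3] no2[of ?u\<^sub>2 ?u\<^sub>3]
        no2[of ?v\<^sub>1 ?v\<^sub>2] no2[of ?v\<^sub>1 ?v\<^sub>3] no2[of ?v\<^sub>2 ?v\<^sub>3] ne
      by (auto simp: card_diff)
    \<comment> \<open>The \<open>u\<close> and \<open>v\<close> with different indices are adjacent.
      Two of each remain outside \<open>X\<close>, which leaves an admissible pair with different
      indices.\<close>
    consider "?u\<^sub>1 \<notin> X \<and> ?v\<^sub>2 \<notin> X" | "?u\<^sub>1 \<notin> X \<and> ?v\<^sub>3 \<notin> X" | "?u\<^sub>2 \<notin> X \<and> ?v\<^sub>1 \<notin> X"
      | "?u\<^sub>2 \<notin> X \<and> ?v\<^sub>3 \<notin> X" | "?u\<^sub>3 \<notin> X \<and> ?v\<^sub>1 \<notin> X" | "?u\<^sub>3 \<notin> X \<and> ?v\<^sub>2 \<notin> X"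
      using u v by blast
    then show ?thesis
    proof cases
      case 1 show ?thesis by (rule path[of ?u\<^sub>1 ?v\<^sub>2]) (use 1 mem ne in \<open>auto simp: X Y card_diff pverts_eq\<close>)
    next
      case 2 show ?thesis by (rule path[of ?u\<^sub>1 ?v\<^sub>3]) (use 2 mem ne in \<open>auto simp: X Y card_diff pverts_eq\<close>)
    next
      case 3 show ?thesis by (rule path[of ?u\<^sub>2 ?v\<^sub>1]) (use 3 mem ne in \<open>auto simp: X Y card_diff pverts_eq\<close>)
    next
      case 4 show ?thesis by (rule path[of ?u\<^sub>2 ?v\<^sub>3]) (use 4 mem ne in \<open>auto simp: X Y card_diff pverts_eq\<close>)
    next
      case 5 show ?thesis by (rule path[of ?u\<^sub>3 ?v\<^sub>1]) (use 5 mem ne in \<open>auto simp: X Y card_diff pverts_eq\<close>)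
    next
      case 6 show ?thesis by (rule path[of ?u\<^sub>3 ?v\<^sub>2]) (use 6 mem ne in \<open>auto simp: X Y card_diff pverts_eq\<close>)
    qed
  qed
qed

text \<open>The invisible pair consists of the other two corners of the square spanned by
  \<open>x\<close> and \<open>y\<close>: their only common neighbours are \<open>x\<close> and
  \<open>y\<close>, so every shortest path between them is blocked.\<close>

lemma not_all_visible_if_distance_2:
  assumes "x \<in> X" "y \<in> X" "x \<in> pverts G" "y \<in> pverts G" "card (diff x y) = 2"
  shows "\<exists>u\<in>pverts G. \<exists>v\<in>pverts G. \<not> visible X u v"
proof -
  obtain a b c where X: "x = (a, b, c)" by (cases x)
  obtain a' b' c' where Y: "y = (a', b', c')" by (cases y)
  have mem: "a \<in> A" "b \<in> B" "c \<in> C" "a' \<in> A" "b' \<in> B" "c' \<in> C"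
    using assms by (auto simp: X Y pverts_eq)
  have "\<exists>u\<in>pverts G. \<exists>v\<in>pverts G. card (diff u v) = 2 \<and> card (diff u x) = 1 \<and> card (diff x v) = 1 \<and>
    (\<forall>w. card (diff u w) = 1 \<and> card (diff w v) = 1 \<longrightarrow> w = x \<or> w = y)"
  proof -
    consider "a \<noteq> a'" "b \<noteq> b'" "c = c'" | "a \<noteq> a'" "b = b'" "c \<noteq> c'" | "a = a'" "b \<noteq> b'" "c \<noteq> c'"
      using assms(5) by (auto simp: X Y card_diff of_bool_def split: if_splits)
    then show ?thesis
    proof cases
      case 1
      then show ?thesis using mem
        by (intro bexI[of _ "(a, b', c)"] bexI[of _ "(a', b, c)"])
          (auto simp: X Y card_diff pverts_eq of_bool_def split: if_splits)
    next
      case 2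
      then show ?thesis using mem
        by (intro bexI[of _ "(a, b, c')"] bexI[of _ "(a', b, c)"])
          (auto simp: X Y card_diff pverts_eq of_bool_def split: if_splits)
    next
      case 3
      then show ?thesis using mem
        by (intro bexI[of _ "(a, b', c)"] bexI[of _ "(a, b, c')"])
          (auto simp: X Y card_diff pverts_eq of_bool_def split: if_splits)
    qed
  qed
  then obtain u v where u: "u \<in> pverts G" and v: "v \<in> pverts G" and uv: "card (diff u v) = 2"
    "card (diff u x) = 1" "card (diff x v) = 1"
    and mid: "\<And>w. card (diff u w) = 1 \<Longrightarrow> card (diff w v) = 1 \<Longrightarrow> w = x \<or> w = y"
    by blast
  have "\<not> visible X u v"
  proof
    assume "visible X u v"
    then obtain p where p: "apath u p v" "\<And>q. apath u q v \<Longrightarrow> length p \<le> length q"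
      "set (inner_verts p) \<inter> X = {}"
      by (auto simp: visible_def shortest_path_def)
    \<comment> \<open>This path runs through \<open>X\<close> and serves only to bound the length of
      a shortest path by 2.\<close>
    have "apath u [(u, x), (x, v)] v"
      using assms(3) u v uv diff_empty_iff[of u v] diff_empty_iff[of u x] diff_empty_iff[of x v]
      by (auto simp: apath_Cons_iff apath_Nil_iff parcs_eq)
    then have "length p \<le> 2" using p(2) by force
    moreover have "length p \<ge> 2" using card_diff_le_length[of u p v] p(1) uv by (auto dest: awalkI_apath)
    ultimately have "length p = Suc (Suc 0)" by simp
    then obtain e f where ef: "p = [e, f]"
      unfolding length_Suc_conv length_0_conv by blast
    then have "card (diff u (fst f)) = 1" "card (diff (fst f) v) = 1" "fst f \<notin> X"
      using p(1,3) by (auto simp: apath_Cons_iff apath_Nil_iff parcs_eq inner_verts_def)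
    then show False using mid assms(1,2) by blast
  qed
  then show ?thesis using u v by blast
qed

section \<open>Characterization and the maximum\<close>

lemma total_mutual_visibility_set_iff:
  "total_mutual_visibility_set X \<longleftrightarrow>
    X \<subseteq> A \<times> B \<times> C \<and> (\<forall>x\<in>X. \<forall>y\<in>X. card (diff x y) \<noteq> 2)"
  using visible_if_no_distance_2[of X] not_all_visible_if_distance_2[of _ X]
  unfolding total_mutual_visibility_set_def with_proj_simps pverts_eq[symmetric]
  by (meson subsetD)

lemma total_mutual_visibility_number_eq:
  assumes "finite A" "finite B" "finite C" "card A \<ge> 4" "card B \<ge> 4" "card C \<ge> 4"
  shows "total_mutual_visibility_number = card A + card B + card C - 6"
  unfolding total_mutual_visibility_number_def
proof (rule Max_eqI)
  have "{X. total_mutual_visibility_set X} \<subseteq> Pow (A \<times> B \<times> C)"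
    by (auto simp: total_mutual_visibility_set_iff)
  then have "finite {X. total_mutual_visibility_set X}"
    by (rule finite_subset) (simp add: assms)
  then show "finite {card X |X. total_mutual_visibility_set X}"
    by (simp add: setcompr_eq_image)
  obtain X where "X \<subseteq> A \<times> B \<times> C" and card: "card X = card A + card B + card C - 6"
    and "\<And>x y. x \<in> X \<Longrightarrow> y \<in> X \<Longrightarrow> card (diff x y) \<noteq> 2"
    using exists_no_distance_2_set[OF assms] by blast
  then have "total_mutual_visibility_set X"
    by (simp add: total_mutual_visibility_set_iff)
  then show "card A + card B + card C - 6 \<in> {card X |X. total_mutual_visibility_set X}"
    unfolding card[symmetric] by blast
next
  fix k assume "k \<in> {card X |X. total_mutual_visibility_set X}"
  then obtain X where k: "k = card X" and X: "X \<subseteq> A \<times> B \<times> C"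
    and no2: "\<And>x y. x \<in> X \<Longrightarrow> y \<in> X \<Longrightarrow> card (diff x y) \<noteq> 2"
    by (auto simp: total_mutual_visibility_set_iff)
  \<comment> \<open>The pools are tagged with the same injections as in \<open>coord\<close>, which
    preserve cardinality.\<close>
  define W where "W i = [Inl ` A, Inr ` Inl ` B, Inr ` Inr ` C] ! i" for i
  have "card X \<le> card (W 0) + card (W 1) + card (W 2) - 6"
  proof (rule card_no_distance_2_le)
    show "finite X" using X assms by (auto intro: finite_subset)
    show "coord x i \<in> W i" if "x \<in> X" "i < 3" for x i
      using that X by (auto simp: W_def coord_def less_3_iff)
  qed (use assms no2 in \<open>auto simp: W_def less_3_iff card_image\<close>)
  then show "k \<le> card A + card B + card C - 6"
    by (simp add: k W_def card_image)
qed

end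

text \<open>An arc of the product moves in one factor only, and in a complete factor it can reach
  any other vertex; so adjacency means differing in exactly one coordinate. Right associativity of
  \<open>\<box>\<close> makes the vertices nested triples as in \<open>coord\<close>.\<close>

lemma hamming_graph_complete_product:
  assumes "K\<^bsub>n\<^sub>1\<^esub> (with_proj G\<^sub>1)" "K\<^bsub>n\<^sub>2\<^esub> (with_proj G\<^sub>2)" "K\<^bsub>n\<^sub>3\<^esub> (with_proj G\<^sub>3)"
  shows "hamming_graph (G\<^sub>1 \<box> G\<^sub>2 \<box> G\<^sub>3) (pverts G\<^sub>1) (pverts G\<^sub>2) (pverts G\<^sub>3)"
  using assms unfolding complete_digraph_pair_def
  by unfold_locales (auto simp: cartesian_product_def card_diff of_bool_def split: if_splits)

theorem theorem3p3:
  fixes n\<^sub>1 n\<^sub>2 n\<^sub>3 :: nat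
    and G\<^sub>1 :: "'a pair_pre_digraph"
    and G\<^sub>2 :: "'b pair_pre_digraph"
    and G\<^sub>3 :: "'c pair_pre_digraph"
  assumes "n\<^sub>1 \<ge> n\<^sub>2" and "n\<^sub>2 \<ge> n\<^sub>3" and "n\<^sub>3 \<ge> 4"
    and "K\<^bsub>n\<^sub>1\<^esub> (with_proj G\<^sub>1)"
    and "K\<^bsub>n\<^sub>2\<^esub> (with_proj G\<^sub>2)"
    and "K\<^bsub>n\<^sub>3\<^esub> (with_proj G\<^sub>3)"
  shows "pre_digraph.total_mutual_visibility_number (with_proj (G\<^sub>1 \<box> G\<^sub>2 \<box> G\<^sub>3)) = n\<^sub>1 + n\<^sub>2 + n\<^sub>3 - 6"
  using hamming_graph.total_mutual_visibility_number_eq[OF hamming_graph_complete_product[OF assms(4-6)]]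
    assms by (simp add: complete_digraph_pair_def)

end
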